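(* Let $\mathbf{X}^*$ be an optimal solution to the semidefinite program $$\max_{\mathbf{X}\succeq\mathbf{0}}\ \mathrm{tr}(\mathbf{A}\mathbf{X})\quad\text{s.t. }\mathrm{tr}(\mathbf{Q}_k\mathbf{X})\le1\ (k=1,\ldots,K),\quad \mathrm{tr}(\mathbf{X})\le P,$$ and let $\mathbf{t}$ be the random vector returned, on input $\mathbf{X}^*$, by the randomized procedure described in the context. Then $\mathbf{t}$ is well defined (i.e. $\max_{1\le k\le K+1}\boldsymbol{\xi}^H\widehat{\mathbf{Q}}_k\boldsymbol{\xi}>0$) and is a feasible solution to the quadratically constrained quadratic program (QCQP) $$\max_{\mathbf{t}\in\mathbb{C}^{M}}\ \mathbf{t}^H\mathbf{A}\mathbf{t}\quad\text{s.t. } \mathbf{t}^H\mathbf{Q}_k\mathbf{t}\le1\ (k=1,\ldots,K),\quad \mathbf{t}^H\mathbf{t}\le P.$$ Moreover, for any $\alpha>0$, $$\Pr\Big\{\mathbf{t}^H\mathbf{A}\mathbf{t}\ge\frac1\alpha\,\mathrm{tr}(\mathbf{A}\mathbf{X}^* )\Big\}\ \ge\ 1-4(K+1)\mu\exp\Big(-\frac{\alpha}{4}\Big),\qquad \mu=\min\{\sqrt{K+1},\,M\}.$$ In particular, with probability at least $1-4(K+1)\mu\exp(-\alpha/4)$, the objective value $\mathbf{t}^H\mathbf{A}\mathbf{t}$ of the returned solution is at least $\frac1\alpha$ times the optimal value of the QCQP.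
   Context: $M,K\ge1$ are integers, $P>0$, $\mathbf{A},\mathbf{Q}_1,\ldots,\mathbf{Q}_K\in\mathbb{C}^{M\times M}$ are Hermitian positive semidefinite, and $\mathbf{Q}_{K+1}:=\frac1P\mathbf{I}$. $(\cdot)^H$ denotes conjugate transpose, and $\mathbf{X}$ ranges over $M\times M$ Hermitian positive semidefinite matrices. Randomized procedure, with input $\mathbf{X}^*$: 1. Decompose $\mathbf{X}^*=\mathbf{\Delta}^H\mathbf{\Delta}$ with $\mathbf{\Delta}\in\mathbb{C}^{M\times M}$. Put $\widetilde{\mathbf{A}}=\mathbf{\Delta}\mathbf{A}\mathbf{\Delta}^H$ and $\widetilde{\mathbf{Q}}_k=\mathbf{\Delta}\mathbf{Q}_k\mathbf{\Delta}^H$ for $k=1,\ldots,K+1$. 2. Find a unitary matrix $\mathbf{U}$ such that $\widehat{\mathbf{A}}=\mathbf{U}^H\widetilde{\mathbf{A}}\mathbf{U}$ is diagonal, and put $\widehat{\mathbf{Q}}_k=\mathbf{U}^H\widetilde{\mathbf{Q}}_k\mathbf{U}$ for $k=1,\ldots,K+1$. 3. Let $\boldsymbol{\xi}\in\mathbb{C}^M$ be a random vector whose entries are independent and uniformly distributed on the unit circle in the complex plane, i.e. $[\boldsymbol{\xi}]_i=e^{\sqrt{-1}\,\theta_i}$ with $\theta_1,\ldots,\theta_M$ independent and uniform between $0$ and $2\pi$. 4. Return $\mathbf{t}=\dfrac{1}{\sqrt{\max_{1\le k\le K+1}\boldsymbol{\xi}^H\widehat{\mathbf{Q}}_k\boldsymbol{\xi}}}\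 \mathbf{\Delta}^H\mathbf{U}\boldsymbol{\xi}$.
   Formalization: The claim that the maximum is positive (t well defined) is made only for A ≠ 0; for A = 0 it fails, e.g. X* = 0 is optimal and the maximum is 0. All other claims are kept for every A, with t = 0 when the maximum is 0. *)

theory Defs
  imports "HOL-Probability.Probability"
begin

definition ctranspose :: "complex^'n^'m \<Rightarrow> complex^'m^'n" where
  "ctranspose A = (\<chi> i j. cnj (A $ j $ i))"

(* The sesquilinear product x^H y; the inner product of the type complex^'n in the
   library is its real part. *)
definition cinner :: "complex^'n \<Rightarrow> complex^'n \<Rightarrow> complex" where
  "cinner x y = (\<Sum>i\<in>UNIV. cnj (x $ i) * y $ i)"

(* x^H A x.  It is used for Hermitian A only, where cinner x (A *v x) is real, so that
   taking the real part loses nothing.  The same applies below to the traces of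
   products of two Hermitian matrices. *)
definition qform :: "complex^'n^'n \<Rightarrow> complex^'n \<Rightarrow> real" where
  "qform A x = Re (cinner x (A *v x))"

definition hermitian :: "complex^'n^'n \<Rightarrow> bool" where
  "hermitian A \<longleftrightarrow> ctranspose A = A"

definition psd :: "complex^'n^'n \<Rightarrow> bool" where
  "psd A \<longleftrightarrow> hermitian A \<and> (\<forall>x. 0 \<le> qform A x)"

definition unitary :: "complex^'n^'n \<Rightarrow> bool" where
  "unitary U \<longleftrightarrow> ctranspose U ** U = mat 1 \<and> U ** ctranspose U = mat 1"

definition diagonal :: "complex^'n^'n \<Rightarrow> bool" where
  "diagonal D \<longleftrightarrow> (\<forall>i j. i \<noteq> j \<longrightarrow> D $ i $ j = 0)"

definition rtrace :: "complex^'n^'n \<Rightarrow> real" where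
  "rtrace A = Re (trace A)"

definition sdp_feasible ::
  "nat \<Rightarrow> real \<Rightarrow> (nat \<Rightarrow> complex^'n^'n) \<Rightarrow> complex^'n^'n \<Rightarrow> bool" where
  "sdp_feasible K P Q X \<longleftrightarrow>
     psd X \<and> (\<forall>k\<in>{1..K}. rtrace (Q k ** X) \<le> 1) \<and> rtrace X \<le> P"

definition sdp_optimal ::
  "nat \<Rightarrow> real \<Rightarrow> complex^'n^'n \<Rightarrow> (nat \<Rightarrow> complex^'n^'n) \<Rightarrow> complex^'n^'n \<Rightarrow> bool" where
  "sdp_optimal K P A Q X \<longleftrightarrow>
     sdp_feasible K P Q X \<and>
     (\<forall>Y. sdp_feasible K P Q Y \<longrightarrow> rtrace (A ** Y) \<le> rtrace (A ** X))"

definition qcqp_feasible ::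
  "nat \<Rightarrow> real \<Rightarrow> (nat \<Rightarrow> complex^'n^'n) \<Rightarrow> complex^'n \<Rightarrow> bool" where
  "qcqp_feasible K P Q t \<longleftrightarrow>
     (\<forall>k\<in>{1..K}. qform (Q k) t \<le> 1) \<and> Re (cinner t t) \<le> P"

(* For P > 0 the feasible set contains 0 and is bounded by the last constraint, so this
   is a supremum of a nonempty set of reals that is bounded above. *)
definition qcqp_value ::
  "nat \<Rightarrow> real \<Rightarrow> complex^'n^'n \<Rightarrow> (nat \<Rightarrow> complex^'n^'n) \<Rightarrow> real" where
  "qcqp_value K P A Q = (SUP t\<in>{t. qcqp_feasible K P Q t}. qform A t)"

(* The family Q_1, ..., Q_K, Q_{K+1} with Q_{K+1} = (1/P) I. *)
definition ext_constraints ::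
  "nat \<Rightarrow> real \<Rightarrow> (nat \<Rightarrow> complex^'n^'n) \<Rightarrow> nat \<Rightarrow> complex^'n^'n" where
  "ext_constraints K P Q = Q(K + 1 := (1 / P) *\<^sub>R mat 1)"

(* U^H (D B D^H) U *)
definition transformed ::
  "complex^'n^'n \<Rightarrow> complex^'n^'n \<Rightarrow> complex^'n^'n \<Rightarrow> complex^'n^'n" where
  "transformed D U B = ctranspose U ** (D ** B ** ctranspose D) ** U"

(* The admissible choices in the two deterministic steps of the procedure: any factor D
   with X = D^H D and any unitary U diagonalizing D A D^H. *)
definition valid_choice ::
  "complex^'n^'n \<Rightarrow> complex^'n^'n \<Rightarrow> complex^'n^'n \<Rightarrow> complex^'n^'n \<Rightarrow> bool" where
  "valid_choice A X D U \<longleftrightarrow>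
     X = ctranspose D ** D \<and> unitary U \<and> diagonal (transformed D U A)"

(* Positive for all phase vectors when A \<noteq> 0 and X is an optimal solution: since
   transformed D U A is diagonal, its quadratic form at a phase vector equals the trace of
   A X, which is then positive.  For A = 0 every feasible X is optimal, including X = 0,
   for which max_constraint is identically 0. *)
definition max_constraint ::
  "nat \<Rightarrow> real \<Rightarrow> (nat \<Rightarrow> complex^'n^'n) \<Rightarrow> complex^'n^'n \<Rightarrow> complex^'n^'n \<Rightarrow>
   complex^'n \<Rightarrow> real" where
  "max_constraint K P Q D U \<xi> =
     (MAX k\<in>{1..K + 1}. qform (transformed D U (ext_constraints K P Q k)) \<xi>)"

(* Meaningful when max_constraint is positive; by the convention 1 / 0 = 0 the value is
   the zero vector when max_constraint is 0. *)
definition returned_vector ::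
  "nat \<Rightarrow> real \<Rightarrow> (nat \<Rightarrow> complex^'n^'n) \<Rightarrow> complex^'n^'n \<Rightarrow> complex^'n^'n \<Rightarrow>
   complex^'n \<Rightarrow> complex^'n" where
  "returned_vector K P Q D U \<xi> =
     (1 / sqrt (max_constraint K P Q D U \<xi>)) *\<^sub>R (ctranspose D *v (U *v \<xi>))"

definition phase_vector :: "('n \<Rightarrow> real) \<Rightarrow> complex^'n" where
  "phase_vector \<theta> = (\<chi> i. exp (\<i> * complex_of_real (\<theta> i)))"

end

theory Submission
  imports Defs
begin

text \<open>Since \<open>U\<^sup>H D A D\<^sup>H U\<close> is diagonal, its quadratic form at any phase vector equals \<open>tr (A X)\<close>, so the
  objective at the returned vector is \<open>tr (A X)\<close> divided by the maximal constraint value, and it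
  suffices to bound the probability that this maximum exceeds \<open>\<alpha>\<close>. Each constraint form
  \<open>\<xi>\<^sup>H B \<xi>\<close> has \<open>B\<close> positive semidefinite with \<open>tr B \<le> 1\<close>. Writing it as a sum of terms
  \<open>\<bar>v\<^sub>i\<^sup>H \<xi>\<bar>\<^sup>2\<close>, convexity of \<open>exp\<close> reduces \<open>E exp (\<xi>\<^sup>H B \<xi> / 4) \<le> \<surd>2\<close> to unit vectors \<open>v\<close>, where it
  follows from the sub-Gaussian bound \<open>E exp (g Re (v\<^sup>H \<xi>)) \<le> exp (g\<^sup>2 / 4)\<close> by integrating over a
  Gaussian \<open>g\<close>. Markov's inequality and a union bound give the failure probability
  \<open>\<surd>2 (K + 1) exp (- \<alpha> / 4)\<close>; the factor \<open>4 \<mu>\<close> of the theorem is not sharp.\<close>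

subsection \<open>Positive semidefinite forms\<close>

lemma cinner_add_right: "cinner x (y + z) = cinner x y + cinner x z"
  by (simp add: cinner_def distrib_left sum.distrib)

lemma cinner_add_left: "cinner (x + y) z = cinner x z + cinner y z"
  by (simp add: cinner_def distrib_right sum.distrib)

lemma cinner_smult_right: "cinner x (c *s y) = c * cinner x y"
  by (simp add: cinner_def sum_distrib_left algebra_simps)

lemma cinner_smult_left: "cinner (c *s x) y = cnj c * cinner x y"
  by (simp add: cinner_def sum_distrib_left algebra_simps)

lemma cinner_scaleR_left: "cinner (r *\<^sub>R x) y = of_real r * cinner x y"
  by (simp add: cinner_def sum_distrib_left scaleR_conv_of_real [where 'a = complex] mult_ac)

lemma cinner_scaleR_right: "cinner x (r *\<^sub>R y) = of_real r * cinner x y"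
  by (simp add: cinner_def sum_distrib_left scaleR_conv_of_real [where 'a = complex] mult_ac)

lemma cinner_commute: "cinner y x = cnj (cinner x y)"
  by (simp add: cinner_def mult.commute)

lemma cinner_self: "cinner x x = of_real ((norm x)\<^sup>2)"
  unfolding cinner_def norm_vec_def L2_set_def
  by (simp add: sum_nonneg mult.commute [of "cnj _"] flip: complex_norm_square)

lemma cinner_matrix_right: "cinner x (M *v y) = cinner (ctranspose M *v x) y"
proof -
  have "cinner x (M *v y) = (\<Sum>i\<in>UNIV. \<Sum>j\<in>UNIV. cnj (x $ i) * M $ i $ j * y $ j)"
    by (simp add: cinner_def matrix_vector_mult_def sum_distrib_left mult.assoc)
  also have "\<dots> = (\<Sum>j\<in>UNIV. \<Sum>i\<in>UNIV. cnj (x $ i) * M $ i $ j * y $ j)"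
    by (rule sum.swap)
  also have "\<dots> = cinner (ctranspose M *v x) y"
    by (simp add: cinner_def matrix_vector_mult_def ctranspose_def sum_distrib_left sum_distrib_right mult_ac)
  finally show ?thesis .
qed

lemma cinner_axis_left [simp]: "cinner (axis i 1) x = x $ i"
proof -
  have "cinner (axis i 1) x = (\<Sum>j\<in>UNIV. if j = i then x $ j else 0)"
    unfolding cinner_def by (rule sum.cong) (auto simp: axis_def)
  then show ?thesis by simp
qed

lemma cinner_axis_right [simp]: "cinner x (axis i 1) = cnj (x $ i)"
  by (subst cinner_commute) simp

lemma ctranspose_ctranspose [simp]: "ctranspose (ctranspose A) = A"
  by (simp add: ctranspose_def)

lemma ctranspose_mult: "ctranspose (A ** B) = ctranspose B ** ctranspose A"
  by (simp add: ctranspose_def matrix_matrix_mult_def vec_eq_iff mult.commute)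

lemma hermitian_cinner: "hermitian A \<Longrightarrow> cinner x (A *v y) = cinner (A *v x) y"
  by (simp add: cinner_matrix_right hermitian_def)

lemma hermitian_component: "hermitian A \<Longrightarrow> A $ j $ i = cnj (A $ i $ j)"
  unfolding hermitian_def ctranspose_def by (metis vec_lambda_beta)

lemma hermitian_qform: "hermitian A \<Longrightarrow> cinner x (A *v x) = of_real (qform A x)"
proof -
  assume A: "hermitian A"
  have "cnj (cinner x (A *v x)) = cinner x (A *v x)"
    by (metis A cinner_commute hermitian_cinner)
  then show ?thesis
    by (simp add: qform_def complex_eq_iff)
qed

lemma matrix_vector_mult_axis: "(A *v axis i 1) $ j = A $ j $ i" for A :: "complex^'n^'m"
proof -
  have "(A *v axis i 1) $ j = (\<Sum>k\<in>UNIV. if k = i then A $ j $ k else 0)"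
    unfolding matrix_vector_mult_def vec_lambda_beta by (intro sum.cong) (auto simp: axis_def)
  then show ?thesis by simp
qed

lemma qform_axis: "qform A (axis i 1) = Re (A $ i $ i)"
  by (simp add: qform_def matrix_vector_mult_axis)

lemma rtrace_eq_sum_qform: "rtrace A = (\<Sum>i\<in>UNIV. qform A (axis i 1))"
  by (simp add: rtrace_def trace_def qform_axis)

lemma scaleR_matrix_vector: "(r *\<^sub>R A) *v x = r *\<^sub>R (A *v x)" for A :: "complex^'n^'m"
  by (simp add: vec_eq_iff matrix_vector_mult_def scaleR_sum_right)

lemma matrix_vector_scaleR: "A *v (r *\<^sub>R x) = r *\<^sub>R (A *v x)" for A :: "complex^'n^'m"
  by (simp add: vec_eq_iff matrix_vector_mult_def scaleR_sum_right)

lemma qform_scaleR: "qform A (r *\<^sub>R x) = r\<^sup>2 * qform A x"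
  by (simp add: qform_def matrix_vector_scaleR cinner_scaleR_left cinner_scaleR_right power2_eq_square)

lemma qform_scaleR_matrix: "qform (r *\<^sub>R A) x = r * qform A x"
  by (simp add: qform_def scaleR_matrix_vector cinner_scaleR_right)

lemma qform_zero [simp]: "qform A 0 = 0"
  by (simp add: qform_def cinner_def)

lemma qform_mat_1: "qform (mat 1) x = (norm x)\<^sup>2"
  by (simp add: qform_def cinner_self)

lemma qform_add:
  assumes "hermitian A"
  shows "qform A (x + y) = qform A x + 2 * Re (cinner x (A *v y)) + qform A y"
proof -
  have "Re (cinner y (A *v x)) = Re (cinner x (A *v y))"
    by (metis assms cinner_commute hermitian_cinner complex_cnj(1) complex_surj cnj.sel(1))
  then show ?thesis
    by (simp add: qform_def matrix_vector_right_distrib cinner_add_left cinner_add_right)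
qed

section \<open>Kernels of semidefinite forms and decomposition into squares\<close>

lemma psd_qform_eq_0:
  assumes A: "psd A" and 0: "qform A x = 0"
  shows "A *v x = 0"
proof (rule ccontr)
  define y where "y = A *v x"
  assume "A *v x \<noteq> 0"
  then have n: "(norm y)\<^sup>2 > 0" by (simp add: y_def)
  have h: "hermitian A" and pos: "\<And>x. 0 \<le> qform A x" using A by (auto simp: psd_def)
  \<comment> \<open>Moving from \<open>x\<close> along \<open>y = A x\<close>, the form starts at 0
    with slope \<open>2 * (norm y)^2\<close>. For this negative \<open>c\<close> the linear term
    outweighs the quadratic one, since \<open>- c * qform A y < (norm y)^2\<close>; the
    \<open>+ 1\<close> keeps the denominator positive when \<open>qform A y = 0\<close>.\<close>
  define c where "c = - (norm y)\<^sup>2 / (qform A y + 1)"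
  have q: "qform A y + 1 > 0" using pos [of y] by simp
  have "qform A (c *\<^sub>R y + x) = c\<^sup>2 * qform A y + 2 * c * (norm y)\<^sup>2"
    using 0 by (simp add: qform_add h qform_scaleR cinner_scaleR_left cinner_self flip: y_def)
  also have "\<dots> < 0"
  proof -
    have "c * qform A y + 2 * (norm y)\<^sup>2 = (norm y)\<^sup>2 * ((qform A y + 2) / (qform A y + 1))"
      using q by (simp add: c_def field_simps)
    also have "\<dots> > 0" using n pos [of y] by (intro mult_pos_pos divide_pos_pos) auto
    finally have "c * (c * qform A y + 2 * (norm y)\<^sup>2) < 0"
      using n q by (intro mult_neg_pos) (auto simp: c_def)
    then show ?thesis by (simp add: power2_eq_square algebra_simps)
  qed
  finally show False using pos by (simp add: leD)
qed

lemma psd_eq_0_iff: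
  assumes "psd A"
  shows "A = 0 \<longleftrightarrow> (\<forall>x. qform A x = 0)"
proof
  assume "\<forall>x. qform A x = 0"
  then have "A *v x = 0" for x using assms psd_qform_eq_0 by blast
  then show "A = 0" by (simp add: matrix_eq)
qed (simp add: qform_def cinner_def)

lemma cinner_mult_cnj: "cinner x y * cnj (cinner x y) = of_real ((cmod (cinner x y))\<^sup>2)"
  by (rule complex_norm_square [symmetric])

text \<open>The induction eliminates one index \<open>a\<close> at a time by passing to the Schur complement,
  as in the Cholesky factorisation.\<close>

lemma psd_sum_squares_on:
  fixes A :: "complex^'n^'n"
  assumes "finite S" "psd A" "\<And>i. i \<notin> S \<Longrightarrow> A *v axis i 1 = 0"
  shows "\<exists>v. \<forall>x. qform A x = (\<Sum>i\<in>S. (cmod (cinner (v i) x))\<^sup>2)"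
  using assms
proof (induction S arbitrary: A rule: finite_induct)
  case empty
  then have "A $ j $ i = 0" for i j
    using matrix_vector_mult_axis [of A i j] by simp
  then have "A *v x = 0" for x
    by (simp add: vec_eq_iff matrix_vector_mult_def)
  then show ?case by (simp add: qform_def cinner_def)
next
  case (insert a S)
  have h: "hermitian A" and pos: "\<And>x. 0 \<le> qform A x" using insert.prems by (auto simp: psd_def)
  define w where "w = A *v axis a 1"
  define q where "q = qform A (axis a 1)"
  have q_w: "w $ a = of_real q"
    using hermitian_qform [OF h, of "axis a 1"] by (simp add: w_def q_def)
  have w_x: "cinner w x = (A *v x) $ a" for x
    using hermitian_cinner [OF h, of "axis a 1" x] by (simp add: w_def)
  show ?case
  proof (cases "q = 0")
    case True
    \<comment> \<open>A zero diagonal entry forces the whole column \<open>a\<close> to vanish, so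
      \<open>A\<close> is already supported on \<open>S\<close> and index \<open>a\<close>
      contributes the zero vector.\<close>
    then have "w = 0" using psd_qform_eq_0 insert.prems(1) by (simp add: w_def q_def)
    then have "A *v axis i 1 = 0" if "i \<notin> S" for i
      using insert.prems(2) [of i] that by (cases "i = a") (auto simp: w_def)
    from insert.IH [OF insert.prems(1) this] obtain v
      where v: "qform A x = (\<Sum>i\<in>S. (cmod (cinner (v i) x))\<^sup>2)" for x by blast
    have "qform A x = (\<Sum>i\<in>insert a S. (cmod (cinner ((v(a := 0)) i) x))\<^sup>2)" for x
    proof -
      have "(\<Sum>i\<in>S. (cmod (cinner ((v(a := 0)) i) x))\<^sup>2) = (\<Sum>i\<in>S. (cmod (cinner (v i) x))\<^sup>2)"
        using insert.hyps by (intro sum.cong) auto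
      then show ?thesis using insert.hyps v by (simp add: cinner_def)
    qed
    then show ?thesis by blast
  next
    case False
    then have q: "q > 0" using pos [of "axis a 1"] by (simp add: q_def)
    \<comment> \<open>Subtracting \<open>w w^H / q\<close>, with \<open>w\<close> the column
      \<open>a\<close>, leaves the Schur complement bordered by zeros. The form loses exactly the
      square of the modulus of \<open>cinner w x\<close>, divided by \<open>q\<close>, which the
      vector \<open>w / sqrt q\<close> restores later.\<close>
    define B where "B = A - (\<chi> i j. w $ i * cnj (w $ j) / of_real q)"
    have B_x: "B *v x = A *v x - (cinner w x / of_real q) *s w" for x
      by (simp add: B_def vec_eq_iff matrix_vector_mult_def cinner_def
          sum_divide_distrib sum_distrib_left sum_subtractf right_diff_distrib mult_ac)
    have B_q: "qform B x = qform A x - (cmod (cinner w x))\<^sup>2 / q" for x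
    proof -
      have "cinner x (B *v x) = cinner x (A *v x) - cinner w x * cnj (cinner w x) / of_real q"
        unfolding B_x diff_conv_add_uminus cinner_add_right
        using cinner_smult_right [of x "- (cinner w x / of_real q)" w]
        by (simp add: cinner_commute [of x w])
      then show ?thesis
        by (simp only: qform_def minus_complex.sel cinner_mult_cnj Re_divide_of_real Re_complex_of_real)
    qed
    have "hermitian B"
      by (simp add: hermitian_def B_def ctranspose_def vec_eq_iff mult.commute [of "cnj _"]
          flip: hermitian_component [OF h])
    moreover have "0 \<le> qform B x" for x
    proof -
      \<comment> \<open>This \<open>c\<close> minimises the form of \<open>A\<close> over all shifts
        of \<open>x\<close> along axis \<open>a\<close>. The minimum is \<open>qform B x\<close>,
        which therefore inherits nonnegativity.\<close>
      define c where "c = - (cinner w x / of_real q)"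
      have "qform A (x + c *s axis a 1) = qform A x + 2 * Re (cinner x (c *s w)) + Re (cnj c * c * of_real q)"
        unfolding qform_add [OF h]
        by (simp add: qform_def vector_scalar_commute cinner_smult_left cinner_smult_right q_w algebra_simps flip: w_def)
      also have "Re (cinner x (c *s w)) = - (cmod (cinner w x))\<^sup>2 / q"
        unfolding cinner_smult_right c_def
        by (simp add: cinner_commute [of x w] cinner_mult_cnj
            flip: of_real_divide)
      also have "cnj c * c * of_real q = of_real ((cmod (cinner w x))\<^sup>2 / q)"
        using q by (simp add: c_def cinner_mult_cnj mult.commute [of "cnj _"])
      finally have "qform A (x + c *s axis a 1) = qform B x"
        by (simp add: B_q)
      then show ?thesis using pos by metis
    qed
    ultimately have "psd B" by (simp add: psd_def)
    moreover have "B *v axis i 1 = 0" if "i \<notin> S" for i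
    proof (cases "i = a")
      case True
      then show ?thesis using q by (simp add: B_x q_w flip: w_def)
    next
      case False
      then have "A *v axis i 1 = 0" using that insert.prems by simp
      moreover from this have "cinner w (axis i 1) = 0" by (simp only: w_x zero_index)
      ultimately show ?thesis by (simp only: B_x) simp
    qed
    ultimately obtain v where v: "qform B x = (\<Sum>i\<in>S. (cmod (cinner (v i) x))\<^sup>2)" for x
      using insert.IH [of B] by blast
    have "qform A x = (\<Sum>i\<in>insert a S. (cmod (cinner ((v(a := (1 / sqrt q) *\<^sub>R w)) i) x))\<^sup>2)" for x
    proof -
      have "(\<Sum>i\<in>S. (cmod (cinner ((v(a := (1 / sqrt q) *\<^sub>R w)) i) x))\<^sup>2)
          = (\<Sum>i\<in>S. (cmod (cinner (v i) x))\<^sup>2)"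
        using insert.hyps by (intro sum.cong) auto
      then show ?thesis using insert.hyps v [of x] q
        by (simp add: B_q cinner_scaleR_left norm_mult norm_divide power_mult_distrib power_divide)
    qed
    then show ?thesis by blast
  qed
qed

text \<open>The trace clause comes from evaluating the squares at the unit vectors and exchanging
  the sums. It lets the squared norms of the \<open>v i\<close> serve as weights of total at most 1
  when the trace is at most 1.\<close>

lemma psd_sum_squares:
  fixes A :: "complex^'n^'n"
  assumes "psd A"
  shows "\<exists>v :: 'n \<Rightarrow> complex^'n. (\<forall>x. qform A x = (\<Sum>i\<in>UNIV. (cmod (cinner (v i) x))\<^sup>2)) \<and>
    rtrace A = (\<Sum>i\<in>UNIV. (norm (v i))\<^sup>2)"
proof -
  obtain v :: "'n \<Rightarrow> complex^'n" where v: "qform A x = (\<Sum>i\<in>UNIV. (cmod (cinner (v i) x))\<^sup>2)" for x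
    using psd_sum_squares_on [of UNIV A] assms by auto
  have "rtrace A = (\<Sum>j\<in>UNIV. \<Sum>i\<in>UNIV. (cmod (v i $ j))\<^sup>2)"
    by (simp add: rtrace_eq_sum_qform v)
  also have "\<dots> = (\<Sum>i\<in>UNIV. \<Sum>j\<in>UNIV. (cmod (v i $ j))\<^sup>2)"
    by (rule sum.swap)
  also have "\<dots> = (\<Sum>i\<in>UNIV. (norm (v i))\<^sup>2)"
    by (simp add: norm_vec_def L2_set_def sum_nonneg)
  finally show ?thesis using v by blast
qed

section \<open>Change of variables by the factor \<open>D\<close> and the unitary
  \<open>U\<close>\<close>

lemma qform_transformed: "qform (transformed D U B) x = qform B (ctranspose D *v (U *v x))"
proof -
  \<comment> \<open>This is a congruence by \<open>ctranspose D ** U\<close>, so the form at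
    \<open>x\<close> is that of \<open>B\<close> at the vector which the procedure rescales.\<close>
  have "transformed D U B = ctranspose (ctranspose D ** U) ** B ** (ctranspose D ** U)"
    by (simp add: transformed_def ctranspose_mult matrix_mul_assoc)
  then show ?thesis
    by (simp add: qform_def cinner_matrix_right ctranspose_mult flip: matrix_vector_mul_assoc)
qed

lemma psd_transformed:
  assumes "psd B"
  shows "psd (transformed D U B)"
proof -
  have "hermitian (transformed D U B)"
    using assms
    by (simp add: psd_def hermitian_def transformed_def ctranspose_mult matrix_mul_assoc)
  then show ?thesis
    using assms by (simp add: psd_def qform_transformed)
qed

text \<open>Cyclicity of the trace cancels \<open>U\<close> against its inverse and brings the
  factors of \<open>D\<close> together as \<open>X\<close>. Thus the constraints of the semidefinite
  program bound the traces of the transformed matrices.\<close>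

lemma rtrace_transformed:
  assumes "valid_choice A X D U"
  shows "rtrace (transformed D U B) = rtrace (B ** X)"
proof -
  have X: "X = ctranspose D ** D" and U: "U ** ctranspose U = mat 1"
    using assms by (auto simp: valid_choice_def unitary_def)
  have "trace (transformed D U B) = trace (ctranspose U ** (D ** B ** ctranspose D ** U))"
    by (simp add: transformed_def matrix_mul_assoc)
  also have "\<dots> = trace (D ** B ** ctranspose D ** (U ** ctranspose U))"
    by (subst trace_mul_sym) (simp add: matrix_mul_assoc)
  also have "\<dots> = trace (D ** (B ** ctranspose D))"
    by (simp add: U matrix_mul_assoc)
  also have "\<dots> = trace (B ** X)"
    by (subst trace_mul_sym) (simp add: X matrix_mul_assoc)
  finally show ?thesis by (simp add: rtrace_def)
qed

text \<open>The entries of a phase vector have modulus 1, so each diagonal entry counts with weight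
  1. Diagonalizing the objective thereby removes its randomness.\<close>

lemma qform_diagonal_phase_vector:
  assumes "diagonal B"
  shows "qform B (phase_vector \<theta>) = rtrace B"
proof -
  let ?\<xi> = "phase_vector \<theta>"
  have B: "(B *v ?\<xi>) $ i = B $ i $ i * ?\<xi> $ i" for i
  proof -
    have "(B *v ?\<xi>) $ i = (\<Sum>j\<in>UNIV. if j = i then B $ i $ i * ?\<xi> $ i else 0)"
      unfolding matrix_vector_mult_def vec_lambda_beta
      using assms by (intro sum.cong) (auto simp: diagonal_def)
    then show ?thesis by simp
  qed
  have unit: "cnj (?\<xi> $ i) * (B $ i $ i * ?\<xi> $ i) = B $ i $ i" for i
  proof -
    have "?\<xi> $ i * cnj (?\<xi> $ i) = 1"
      using complex_norm_square [of "?\<xi> $ i"] by (simp add: phase_vector_def)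
    then have "B $ i $ i * (?\<xi> $ i * cnj (?\<xi> $ i)) = B $ i $ i" by simp
    then show ?thesis by (simp only: mult_ac)
  qed
  show ?thesis
    by (simp add: qform_def cinner_def rtrace_def trace_def B unit)
qed

text \<open>The matrix \<open>x x^H\<close>, which lifts a point of the QCQP to the semidefinite
  program: traces against the lift are quadratic forms in \<open>x\<close>.\<close>

definition rank_one :: "complex^'n \<Rightarrow> complex^'n^'n" where
  "rank_one x = (\<chi> i j. x $ i * cnj (x $ j))"

lemma psd_rank_one: "psd (rank_one x)"
proof -
  have "rank_one x *v y = cinner x y *s x" for y
    by (simp add: rank_one_def vec_eq_iff matrix_vector_mult_def cinner_def sum_distrib_left sum_distrib_right mult_ac)
  then have "qform (rank_one x) y = (cmod (cinner x y))\<^sup>2" for y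
    unfolding qform_def
    by (simp add: cinner_smult_right cinner_commute [of y x] flip: complex_norm_square of_real_power)
  moreover have "hermitian (rank_one x)"
    by (simp add: hermitian_def ctranspose_def rank_one_def vec_eq_iff)
  ultimately show ?thesis by (simp add: psd_def)
qed

lemma rtrace_mult_rank_one: "rtrace (B ** rank_one x) = qform B x"
  by (simp add: rtrace_def trace_def qform_def cinner_def rank_one_def matrix_matrix_mult_def
      matrix_vector_mult_def sum_distrib_left mult_ac)

lemma rtrace_rank_one: "rtrace (rank_one x) = Re (cinner x x)"
  by (simp add: rtrace_def trace_def rank_one_def cinner_def mult.commute)

lemma sdp_feasible_rank_one: "qcqp_feasible K P Q x \<Longrightarrow> sdp_feasible K P Q (rank_one x)"
  by (simp add: qcqp_feasible_def sdp_feasible_def psd_rank_one rtrace_mult_rank_one rtrace_rank_one)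

subsection \<open>Exponential moments of forms at random phases\<close>

lemma cosh_le_exp_half_square: "cosh y \<le> exp (y\<^sup>2 / 2)" for y :: real
proof -
  \<comment> \<open>The power series are compared term by term; this is
    \<open>2^n * n! <= (2 n)!\<close>.\<close>
  have fact: "inverse (fact (2 * n)) \<le> inverse (fact n) * (1 / 2 :: real) ^ n" for n :: nat
  proof (induction n)
    case (Suc n)
    have "inverse (fact (2 * Suc n) :: real) = inverse (fact (2 * n)) * (1 / ((2 * real n + 1) * (2 * real n + 2)))"
      by (simp add: field_simps)
    also have "\<dots> \<le> (inverse (fact n) * (1 / 2) ^ n) * (1 / (1 * (2 * real n + 2)))"
      using Suc by (intro mult_mono divide_left_mono) auto
    also have "\<dots> = inverse (fact (Suc n)) * (1 / 2) ^ Suc n"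
      by (simp add: field_simps)
    finally show ?case .
  qed simp
  have "(\<lambda>n. if even n then y ^ n /\<^sub>R fact n else 0) sums cosh y"
    by (rule cosh_converges)
  then have c: "(\<lambda>n. y ^ (2 * n) /\<^sub>R fact (2 * n)) sums cosh y"
    by (subst (asm) sums_mono_reindex [of "\<lambda>n. 2 * n", symmetric])
       (auto simp: strict_mono_def elim!: evenE)
  have e: "(\<lambda>n. (y\<^sup>2 / 2) ^ n /\<^sub>R fact n) sums exp (y\<^sup>2 / 2)"
    by (rule exp_converges)
  show ?thesis
  proof (rule sums_le [OF _ c e])
    fix n
    have "y ^ (2 * n) /\<^sub>R fact (2 * n) = (y\<^sup>2) ^ n * inverse (fact (2 * n))"
      by (simp add: power_mult)
    also have "\<dots> \<le> (y\<^sup>2) ^ n * (inverse (fact n) * (1 / 2) ^ n)"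
      by (intro mult_left_mono fact) auto
    finally show "y ^ (2 * n) /\<^sub>R fact (2 * n) \<le> (y\<^sup>2 / 2) ^ n /\<^sub>R fact n"
      by (simp add: power_divide field_simps)
  qed
qed

text \<open>Rewriting the sum as a product is what gives the constant 1/4: the bounds on the two
  factors combine by the parallelogram identity.\<close>

lemma cosh_add_cosh_le: "cosh p + cosh q \<le> 2 * exp ((p\<^sup>2 + q\<^sup>2) / 4)" for p q :: real
proof -
  have "cosh p + cosh q = 2 * (cosh ((p + q) / 2) * cosh ((p - q) / 2))"
    using cosh_add [of "(p + q) / 2" "(p - q) / 2"] cosh_diff [of "(p + q) / 2" "(p - q) / 2"]
    by (simp add: field_simps)
  also have "\<dots> \<le> 2 * (exp (((p + q) / 2)\<^sup>2 / 2) * exp (((p - q) / 2)\<^sup>2 / 2))"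
    by (intro mult_left_mono mult_mono cosh_le_exp_half_square) (auto simp: cosh_real_nonneg)
  also have "\<dots> = 2 * exp ((p\<^sup>2 + q\<^sup>2) / 4)"
    by (simp flip: exp_add add: power2_eq_square field_simps)
  finally show ?thesis .
qed

text \<open>The four quarter-turn translates of the integrand are averaged pointwise.\<close>

lemma integral_exp_trig_le:
  fixes a b :: real
  defines "f \<equiv> \<lambda>s. exp (a * cos s + b * sin s)"
  shows "integral {0..2 * pi} f \<le> 2 * pi * exp ((a\<^sup>2 + b\<^sup>2) / 4)"
proof -
  have cont: "continuous_on S (\<lambda>s. f (s + c))" for S c
    unfolding f_def by (intro continuous_intros)
  have int: "f integrable_on {x..y}" "(\<lambda>s. f (s + c)) integrable_on {x..y}" for x y c
    using cont [of _ 0] cont by (auto intro!: integrable_continuous_real)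
  have shift: "integral {c..pi / 2 + c} f = integral {0..pi / 2} (\<lambda>s. f (s + c))" for c
    using integral_shift_real_ivl [of c c "pi / 2 + c" f] by (simp add: f_def)
  have "integral {0..2 * pi} f =
      integral {0..pi / 2} f + integral {pi / 2..pi} f + integral {pi..3 * pi / 2} f
      + integral {3 * pi / 2..2 * pi} f"
    using Henstock_Kurzweil_Integration.integral_combine [where a = 0 and c = "pi / 2" and b = "2 * pi" and f = f]
      Henstock_Kurzweil_Integration.integral_combine [where a = "pi / 2" and c = pi and b = "2 * pi" and f = f]
      Henstock_Kurzweil_Integration.integral_combine [where a = pi and c = "3 * pi / 2" and b = "2 * pi" and f = f] int
    by simp
  also have "\<dots> = integral {0..pi / 2} f + integral {0..pi / 2} (\<lambda>s. f (s + pi / 2))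
      + integral {0..pi / 2} (\<lambda>s. f (s + pi)) + integral {0..pi / 2} (\<lambda>s. f (s + 3 * pi / 2))"
    using shift [of "pi / 2"] shift [of pi] shift [of "3 * pi / 2"] by (simp add: field_simps)
  also have "\<dots> = integral {0..pi / 2} (\<lambda>s. f s + f (s + pi / 2) + f (s + pi) + f (s + 3 * pi / 2))"
    using int by (simp add: integral_add integrable_add)
  also have "\<dots> \<le> integral {0..pi / 2} (\<lambda>s. 4 * exp ((a\<^sup>2 + b\<^sup>2) / 4))"
  proof (rule integral_le)
    show "(\<lambda>s. f s + f (s + pi / 2) + f (s + pi) + f (s + 3 * pi / 2)) integrable_on {0..pi / 2}"
      using int by (intro integrable_add)
  next
    fix s :: real
    \<comment> \<open>These are the values of \<open>a cos + b sin\<close> at \<open>s\<close> and a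
      quarter turn later. A half turn flips their signs, so the four exponentials pair into two cosh
      terms, and \<open>p^2 + q^2 = a^2 + b^2\<close> makes the bound independent of
      \<open>s\<close>.\<close>
    define p q where "p = a * cos s + b * sin s" and "q = b * cos s - a * sin s"
    have s3: "cos (s + 3 * pi / 2) = sin s" "sin (s + 3 * pi / 2) = - cos s"
    proof -
      have "s + 3 * pi / 2 = (s + pi / 2) + pi" by simp
      then show "cos (s + 3 * pi / 2) = sin s" "sin (s + 3 * pi / 2) = - cos s"
        by (simp_all only: cos_periodic_pi sin_periodic_pi) (simp_all add: cos_add sin_add)
    qed
    have s1: "cos (s + pi / 2) = - sin s" "sin (s + pi / 2) = cos s"
      by (simp_all add: cos_add sin_add)
    have "f s = exp p" "f (s + pi / 2) = exp q" "f (s + pi) = exp (- p)" "f (s + 3 * pi / 2) = exp (- q)"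
      unfolding f_def s1 s3 p_def q_def by simp_all
    then have "f s + f (s + pi / 2) + f (s + pi) + f (s + 3 * pi / 2) = 2 * (cosh p + cosh q)"
      by (simp add: cosh_field_def field_simps)
    also have "\<dots> \<le> 2 * (2 * exp ((p\<^sup>2 + q\<^sup>2) / 4))"
      by (intro mult_left_mono cosh_add_cosh_le) auto
    also have "p\<^sup>2 + q\<^sup>2 = (a\<^sup>2 + b\<^sup>2) * ((cos s)\<^sup>2 + (sin s)\<^sup>2)"
      unfolding p_def q_def by algebra
    finally show "f s + f (s + pi / 2) + f (s + pi) + f (s + 3 * pi / 2) \<le> 4 * exp ((a\<^sup>2 + b\<^sup>2) / 4)"
      by simp
  qed auto
  finally show ?thesis by simp
qed

text \<open>Jensen's inequality with the missing mass \<open>1 - sum p I\<close> placed at 0, where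
  exp is 1. The tangent line of exp at the weighted sum \<open>u\<close> is averaged over the points
  \<open>z i\<close> and 0.\<close>

lemma exp_convex_comb_le:
  fixes p z :: "'i \<Rightarrow> real"
  assumes p: "\<And>i. i \<in> I \<Longrightarrow> 0 \<le> p i" "sum p I \<le> 1"
  shows "exp (\<Sum>i\<in>I. p i * z i) \<le> (\<Sum>i\<in>I. p i * exp (z i)) + (1 - sum p I)"
proof -
  define u where "u = (\<Sum>i\<in>I. p i * z i)"
  have "exp u * (1 + (z i - u)) \<le> exp (z i)" for i
    using mult_left_mono [OF exp_ge_add_one_self [of "z i - u"], of "exp u"]
    by (simp flip: exp_add)
  then have "(\<Sum>i\<in>I. p i * (exp u * (1 + (z i - u)))) \<le> (\<Sum>i\<in>I. p i * exp (z i))"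
    using p by (intro sum_mono mult_left_mono)
  also have "(\<Sum>i\<in>I. p i * (exp u * (1 + (z i - u)))) = exp u * (sum p I * (1 - u) + u)"
  proof -
    have "(\<Sum>i\<in>I. p i * (exp u * (1 + (z i - u)))) = (\<Sum>i\<in>I. exp u * (p i * (1 - u) + p i * z i))"
      by (simp add: algebra_simps)
    also have "\<dots> = exp u * (sum p I * (1 - u) + u)"
      by (simp add: u_def sum.distrib flip: sum_distrib_left sum_distrib_right)
    finally show ?thesis .
  qed
  finally have 1: "exp u * (sum p I * (1 - u) + u) \<le> (\<Sum>i\<in>I. p i * exp (z i))" .
  have "exp u * (1 - u) \<le> 1"
    using mult_left_mono [OF exp_ge_add_one_self [of "- u"], of "exp u"]
    by (simp flip: exp_add)
  then have "(1 - sum p I) * (exp u * (1 - u)) \<le> (1 - sum p I) * 1"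
    using p by (intro mult_left_mono) auto
  with 1 show ?thesis unfolding u_def [symmetric] by (simp add: algebra_simps)
qed

section \<open>Sub-Gaussian moments and tail bounds for independent uniform phases\<close>

locale random_phases = prob_space W for W :: "'w measure" +
  fixes \<theta> :: "'m::finite \<Rightarrow> 'w \<Rightarrow> real"
  assumes indep: "indep_vars (\<lambda>_. borel) \<theta> UNIV"
    and distr_phase: "distr W borel (\<theta> i) = uniform_measure lborel {0..2 * pi}"
begin

abbreviation phases :: "'w \<Rightarrow> complex^'m" where
  "phases \<omega> \<equiv> phase_vector (\<lambda>i. \<theta> i \<omega>)"

lemma measurable_phase [measurable]: "\<theta> i \<in> borel_measurable W"
  using indep unfolding indep_vars_def by auto

text \<open>The law of the phase makes this the mean over a full period. The bound is the moment
  generating function, at 1, of a centred Gaussian with the same variance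
  \<open>(a^2 + b^2) / 2\<close>.\<close>

lemma nn_integral_exp_phase_le:
  "(\<integral>\<^sup>+\<omega>. ennreal (exp (a * cos (\<theta> i \<omega>) + b * sin (\<theta> i \<omega>))) \<partial>W)
    \<le> ennreal (exp ((a\<^sup>2 + b\<^sup>2) / 4))"
proof -
  define f where "f s = exp (a * cos s + b * sin s)" for s :: real
  have f_meas: "(\<lambda>s. ennreal (f s)) \<in> borel_measurable borel"
    unfolding f_def by measurable
  have "f integrable_on {0..2 * pi}"
    unfolding f_def by (intro integrable_continuous_real continuous_intros)
  then have f_int: "(f has_integral integral {0..2 * pi} f) {0..2 * pi}"
    by (rule integrable_integral)
  have "(\<integral>\<^sup>+\<omega>. ennreal (f (\<theta> i \<omega>)) \<partial>W) = (\<integral>\<^sup>+s. ennreal (f s) \<partial>distr W borel (\<theta> i))"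
    using f_meas by (subst nn_integral_distr) auto
  also have "\<dots> = (\<integral>\<^sup>+s. ennreal (f s) * indicator {0..2 * pi} s \<partial>lborel) / ennreal (2 * pi)"
    unfolding distr_phase using f_meas by (subst nn_integral_uniform_measure) auto
  also have "\<dots> = ennreal (integral {0..2 * pi} f) / ennreal (2 * pi)"
    by (subst nn_integral_has_integral_lebesgue' [OF _ f_int]) (auto simp: f_def)
  also have "\<dots> = ennreal (integral {0..2 * pi} f / (2 * pi))"
    by (intro divide_ennreal integral_nonneg has_integral_integrable [OF f_int]) (auto simp: f_def)
  also have "\<dots> \<le> ennreal (exp ((a\<^sup>2 + b\<^sup>2) / 4))"
    using integral_exp_trig_le [of a b] unfolding f_def
    by (intro ennreal_leI) (simp add: divide_le_eq mult.commute)
  finally show ?thesis by (simp add: f_def)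
qed

lemma cinner_phases:
  "Re (cinner v (phases \<omega>)) = (\<Sum>i\<in>UNIV. Re (v $ i) * cos (\<theta> i \<omega>) + Im (v $ i) * sin (\<theta> i \<omega>))"
  "Im (cinner v (phases \<omega>)) = (\<Sum>i\<in>UNIV. Re (v $ i) * sin (\<theta> i \<omega>) - Im (v $ i) * cos (\<theta> i \<omega>))"
  unfolding cinner_def phase_vector_def
  by (simp_all add: Re_exp Im_exp)

lemma measurable_cinner_phases [measurable]:
  "(\<lambda>\<omega>. Re (cinner v (phases \<omega>))) \<in> borel_measurable W"
  "(\<lambda>\<omega>. Im (cinner v (phases \<omega>))) \<in> borel_measurable W"
  "(\<lambda>\<omega>. cmod (cinner v (phases \<omega>))) \<in> borel_measurable W"
  unfolding cmod_def cinner_phases by measurable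

text \<open>The real part is a sum of functions of the separate phases, so its exponential is a
  product and independence factorizes the expectation. The exponents then add up to the squared norm
  of \<open>v\<close>.\<close>

lemma nn_integral_exp_linear_le:
  "(\<integral>\<^sup>+\<omega>. ennreal (exp (g * Re (cinner v (phases \<omega>)))) \<partial>W) \<le> ennreal (exp (g\<^sup>2 * (norm v)\<^sup>2 / 4))"
proof -
  let ?e = "\<lambda>i s. ennreal (exp (g * Re (v $ i) * cos s + g * Im (v $ i) * sin s))"
  have n: "(norm v)\<^sup>2 = (\<Sum>i\<in>UNIV. (Re (v $ i))\<^sup>2 + (Im (v $ i))\<^sup>2)"
    by (simp add: norm_vec_def L2_set_def sum_nonneg cmod_power2)
  have "(\<integral>\<^sup>+\<omega>. ennreal (exp (g * Re (cinner v (phases \<omega>)))) \<partial>W)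
      = (\<integral>\<^sup>+\<omega>. (\<Prod>i\<in>UNIV. ?e i (\<theta> i \<omega>)) \<partial>W)"
    by (simp add: cinner_phases sum_distrib_left exp_sum prod_ennreal distrib_left mult.assoc)
  also have "\<dots> = (\<Prod>i\<in>UNIV. \<integral>\<^sup>+\<omega>. ?e i (\<theta> i \<omega>) \<partial>W)"
    by (intro indep_vars_nn_integral indep_vars_compose2 [OF indep]) auto
  also have "\<dots> \<le> (\<Prod>i\<in>UNIV. ennreal (exp (((g * Re (v $ i))\<^sup>2 + (g * Im (v $ i))\<^sup>2) / 4)))"
    by (intro prod_mono_ennreal nn_integral_exp_phase_le)
  also have "\<dots> = ennreal (exp (g\<^sup>2 * (norm v)\<^sup>2 / 4))"
    unfolding n
    by (simp add: prod_ennreal sum_distrib_left sum_divide_distrib power_mult_distrib distrib_left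
        flip: exp_sum)
  finally show ?thesis .
qed

text \<open>The square is linearized: \<open>exp (y^2 / 2)\<close> is the expectation of
  \<open>exp (g * y)\<close> over a standard Gaussian \<open>g\<close>. After exchanging the
  integrals the linear bound applies for each fixed \<open>g\<close>, and \<open>sqrt 2\<close> is
  the Gaussian expectation of \<open>exp (g^2 / 4)\<close>.\<close>

lemma nn_integral_exp_Re_square_le:
  assumes "norm v \<le> 1"
  shows "(\<integral>\<^sup>+\<omega>. ennreal (exp ((Re (cinner v (phases \<omega>)))\<^sup>2 / 2)) \<partial>W) \<le> ennreal (sqrt 2)"
proof -
  define Y where "Y \<omega> = Re (cinner v (phases \<omega>))" for \<omega>
  have [measurable]: "Y \<in> borel_measurable W" unfolding Y_def by measurable
  interpret pair_sigma_finite W lborel ..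
  have square: "ennreal (exp (y\<^sup>2 / 2)) = (\<integral>\<^sup>+g. ennreal (normal_density 0 1 g * exp (g * y)) \<partial>lborel)"
    for y :: real
  proof -
    \<comment> \<open>Completing the square turns the tilted standard density into a normal density
      centred at \<open>y\<close>.\<close>
    have "normal_density 0 1 g * exp (g * y) = exp (y\<^sup>2 / 2) * normal_density y 1 g" for g
      unfolding normal_density_def
      by (simp flip: exp_add add: power2_eq_square field_simps)
    then have "(\<integral>\<^sup>+g. ennreal (normal_density 0 1 g * exp (g * y)) \<partial>lborel)
        = (\<integral>\<^sup>+g. ennreal (exp (y\<^sup>2 / 2)) * ennreal (normal_density y 1 g) \<partial>lborel)"
      by (simp add: ennreal_mult')
    also have "\<dots> = ennreal (exp (y\<^sup>2 / 2)) * (\<integral>\<^sup>+g. ennreal (normal_density y 1 g) \<partial>lborel)"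
      by (rule nn_integral_cmult) measurable
    also have "(\<integral>\<^sup>+g. ennreal (normal_density y 1 g) \<partial>lborel) = 1"
      by (subst nn_integral_eq_integral) auto
    finally show ?thesis by simp
  qed
  have "(\<integral>\<^sup>+\<omega>. ennreal (exp ((Y \<omega>)\<^sup>2 / 2)) \<partial>W)
      = (\<integral>\<^sup>+\<omega>. (\<integral>\<^sup>+g. ennreal (normal_density 0 1 g * exp (g * Y \<omega>)) \<partial>lborel) \<partial>W)"
    by (simp add: square)
  also have "\<dots> = (\<integral>\<^sup>+g. (\<integral>\<^sup>+\<omega>. ennreal (normal_density 0 1 g * exp (g * Y \<omega>)) \<partial>W) \<partial>lborel)"
    by (rule Fubini' [symmetric]) measurable
  also have "\<dots> = (\<integral>\<^sup>+g. ennreal (normal_density 0 1 g) * (\<integral>\<^sup>+\<omega>. ennreal (exp (g * Y \<omega>)) \<partial>W) \<partial>lborel)"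
    by (simp add: ennreal_mult' nn_integral_cmult)
  also have "\<dots> \<le> (\<integral>\<^sup>+g. ennreal (sqrt 2) * ennreal (normal_density 0 (sqrt 2) g) \<partial>lborel)"
  proof (rule nn_integral_mono)
    fix g :: real
    have "(\<integral>\<^sup>+\<omega>. ennreal (exp (g * Y \<omega>)) \<partial>W) \<le> ennreal (exp (g\<^sup>2 * (norm v)\<^sup>2 / 4))"
      unfolding Y_def by (rule nn_integral_exp_linear_le)
    also have "\<dots> \<le> ennreal (exp (g\<^sup>2 / 4))"
      using assms by (intro ennreal_leI) (simp add: mult_left_le power_le_one)
    finally have "ennreal (normal_density 0 1 g) * (\<integral>\<^sup>+\<omega>. ennreal (exp (g * Y \<omega>)) \<partial>W)
        \<le> ennreal (normal_density 0 1 g) * ennreal (exp (g\<^sup>2 / 4))"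
      by (intro mult_left_mono) auto
    also have "\<dots> = ennreal (normal_density 0 1 g * exp (g\<^sup>2 / 4))"
      by (simp add: ennreal_mult')
    \<comment> \<open>The factor \<open>exp (g^2 / 4)\<close> weakens the Gaussian decay to that of
      variance 2, and the change of normalization leaves \<open>sqrt 2\<close>.\<close>
    also have "normal_density 0 1 g * exp (g\<^sup>2 / 4) = sqrt 2 * normal_density 0 (sqrt 2) g"
      unfolding normal_density_def
      by (simp flip: exp_add add: real_sqrt_mult field_simps)
    finally show "ennreal (normal_density 0 1 g) * (\<integral>\<^sup>+\<omega>. ennreal (exp (g * Y \<omega>)) \<partial>W)
        \<le> ennreal (sqrt 2) * ennreal (normal_density 0 (sqrt 2) g)"
      by (simp add: ennreal_mult')
  qed
  also have "\<dots> = ennreal (sqrt 2) * (\<integral>\<^sup>+g. ennreal (normal_density 0 (sqrt 2) g) \<partial>lborel)"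
    by (rule nn_integral_cmult) measurable
  also have "(\<integral>\<^sup>+g. ennreal (normal_density 0 (sqrt 2) g) \<partial>lborel) = 1"
    by (subst nn_integral_eq_integral) auto
  finally show ?thesis by (simp add: Y_def)
qed

text \<open>Real and imaginary parts need not be independent, so the product
  \<open>exp (a / 4) * exp (b / 4)\<close> is bounded by the mean of \<open>exp (a / 2)\<close> and
  \<open>exp (b / 2)\<close>. This is why the rate drops from 1/2 to 1/4.\<close>

lemma nn_integral_exp_cmod_square_le:
  assumes "norm v \<le> 1"
  shows "(\<integral>\<^sup>+\<omega>. ennreal (exp ((cmod (cinner v (phases \<omega>)))\<^sup>2 / 4)) \<partial>W) \<le> ennreal (sqrt 2)"
proof -
  \<comment> \<open>Multiplying \<open>v\<close> by the imaginary unit turns the imaginary part of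
    the product into a real part and keeps the norm.\<close>
  define w where "w = (\<chi> i. \<i> * v $ i)"
  have w: "norm w \<le> 1"
    using assms by (simp add: w_def norm_vec_def norm_mult)
  have Im: "Im (cinner v x) = Re (cinner w x)" for x
    by (simp add: w_def cinner_def)
  let ?e = "\<lambda>v \<omega>. ennreal (exp ((Re (cinner v (phases \<omega>)))\<^sup>2 / 2))"
  have "(\<integral>\<^sup>+\<omega>. ennreal (exp ((cmod (cinner v (phases \<omega>)))\<^sup>2 / 4)) \<partial>W)
      \<le> (\<integral>\<^sup>+\<omega>. ennreal (1 / 2) * (?e v \<omega> + ?e w \<omega>) \<partial>W)"
  proof (rule nn_integral_mono)
    fix \<omega>
    define a b where "a = (Re (cinner v (phases \<omega>)))\<^sup>2" and "b = (Re (cinner w (phases \<omega>)))\<^sup>2"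
    have "exp ((a + b) / 4) = exp (a / 4) * exp (b / 4)"
      by (simp flip: exp_add add: field_simps)
    also have "\<dots> \<le> 1 / 2 * ((exp (a / 4))\<^sup>2 + (exp (b / 4))\<^sup>2)"
      using sum_squares_bound [of "exp (a / 4)" "exp (b / 4)"] by simp
    also have "\<dots> = 1 / 2 * (exp (a / 2) + exp (b / 2))"
      by (simp flip: exp_double)
    finally have "ennreal (exp ((a + b) / 4)) \<le> ennreal (1 / 2 * (exp (a / 2) + exp (b / 2)))"
      by (rule ennreal_leI)
    then show "ennreal (exp ((cmod (cinner v (phases \<omega>)))\<^sup>2 / 4))
        \<le> ennreal (1 / 2) * (?e v \<omega> + ?e w \<omega>)"
      unfolding cmod_power2 Im a_def b_def by (simp only: ennreal_mult' ennreal_plus exp_ge_zero)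
  qed
  also have "\<dots> = ennreal (1 / 2) * ((\<integral>\<^sup>+\<omega>. ?e v \<omega> \<partial>W) + (\<integral>\<^sup>+\<omega>. ?e w \<omega> \<partial>W))"
    by (simp add: nn_integral_cmult nn_integral_add)
  also have "\<dots> \<le> ennreal (1 / 2) * (ennreal (sqrt 2) + ennreal (sqrt 2))"
    by (intro mult_left_mono add_mono nn_integral_exp_Re_square_le assms w) auto
  also have "\<dots> = ennreal (1 / 2 * (sqrt 2 + sqrt 2))"
    by (simp only: ennreal_mult' ennreal_plus real_sqrt_ge_zero zero_le_numeral)
  finally show ?thesis by simp
qed

lemma measurable_qform_phases:
  assumes "psd B"
  shows "(\<lambda>\<omega>. qform B (phases \<omega>)) \<in> borel_measurable W"
proof -
  obtain v :: "'m \<Rightarrow> complex^'m" where "\<And>x. qform B x = (\<Sum>i\<in>UNIV. (cmod (cinner (v i) x))\<^sup>2)"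
    using psd_sum_squares [OF assms] by blast
  then show ?thesis
    by (simp only:) (intro borel_measurable_sum borel_measurable_power measurable_cinner_phases)
qed

lemma nn_integral_exp_qform_le:
  assumes "psd B" "rtrace B \<le> 1"
  shows "(\<integral>\<^sup>+\<omega>. ennreal (exp (qform B (phases \<omega>) / 4)) \<partial>W) \<le> ennreal (sqrt 2)"
proof -
  obtain v :: "'m \<Rightarrow> complex^'m"
    where v: "\<And>x. qform B x = (\<Sum>i\<in>UNIV. (cmod (cinner (v i) x))\<^sup>2)"
      and tr: "rtrace B = (\<Sum>i\<in>UNIV. (norm (v i))\<^sup>2)"
    using psd_sum_squares [OF assms(1)] by blast
  define p where "p i = (norm (v i))\<^sup>2" for i
  \<comment> \<open>For \<open>v i = 0\<close> the direction \<open>sgn (v i)\<close> is 0 and the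
    weight \<open>p i\<close> vanishes as well; in every case its norm is at most 1, as the moment
    bound requires.\<close>
  define z where "z i \<omega> = (cmod (cinner (sgn (v i)) (phases \<omega>)))\<^sup>2 / 4" for i \<omega>
  have p: "0 \<le> p i" "sum p UNIV \<le> 1" for i
    using assms(2) by (simp_all add: p_def tr)
  have [measurable]: "z i \<in> borel_measurable W" for i
    unfolding z_def
    by (intro borel_measurable_divide borel_measurable_power measurable_cinner_phases
        borel_measurable_const)
  have q: "qform B (phases \<omega>) / 4 = (\<Sum>i\<in>UNIV. p i * z i \<omega>)" for \<omega>
  proof -
    have "cmod (cinner (v i) x) = norm (v i) * cmod (cinner (sgn (v i)) x)" for i x
    proof -
      have "v i = norm (v i) *\<^sub>R sgn (v i)" by (cases "v i = 0") (simp_all add: sgn_div_norm)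
      then have "cinner (v i) x = of_real (norm (v i)) * cinner (sgn (v i)) x"
        by (metis cinner_scaleR_left)
      then show ?thesis by (simp add: norm_mult)
    qed
    then show ?thesis
      by (simp add: v p_def z_def power_mult_distrib sum_divide_distrib)
  qed
  have "(\<integral>\<^sup>+\<omega>. ennreal (exp (qform B (phases \<omega>) / 4)) \<partial>W)
      \<le> (\<integral>\<^sup>+\<omega>. (\<Sum>i\<in>UNIV. ennreal (p i) * ennreal (exp (z i \<omega>))) + ennreal (1 - sum p UNIV) \<partial>W)"
  proof (rule nn_integral_mono)
    fix \<omega>
    have "ennreal (exp (qform B (phases \<omega>) / 4))
        \<le> ennreal ((\<Sum>i\<in>UNIV. p i * exp (z i \<omega>)) + (1 - sum p UNIV))"
      unfolding q using p by (intro ennreal_leI exp_convex_comb_le)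
    also have "\<dots> = (\<Sum>i\<in>UNIV. ennreal (p i) * ennreal (exp (z i \<omega>))) + ennreal (1 - sum p UNIV)"
      using p by (simp add: ennreal_plus sum_nonneg ennreal_mult' flip: sum_ennreal)
    finally show "ennreal (exp (qform B (phases \<omega>) / 4))
        \<le> (\<Sum>i\<in>UNIV. ennreal (p i) * ennreal (exp (z i \<omega>))) + ennreal (1 - sum p UNIV)" .
  qed
  also have "\<dots> = (\<Sum>i\<in>UNIV. ennreal (p i) * (\<integral>\<^sup>+\<omega>. ennreal (exp (z i \<omega>)) \<partial>W)) + ennreal (1 - sum p UNIV)"
    by (simp add: nn_integral_add nn_integral_sum nn_integral_cmult emeasure_space_1)
  \<comment> \<open>The missing mass is enlarged by the factor \<open>sqrt 2\<close>, so that the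
    total mass 1 gives exactly \<open>sqrt 2\<close>.\<close>
  also have "\<dots> \<le> (\<Sum>i\<in>UNIV. ennreal (p i) * ennreal (sqrt 2)) + ennreal ((1 - sum p UNIV) * sqrt 2)"
    unfolding z_def using p
    by (intro add_mono sum_mono mult_left_mono nn_integral_exp_cmod_square_le ennreal_leI)
       (auto simp: norm_sgn intro: mult_left_mono [of 1 "sqrt 2" "1 - sum p UNIV", simplified])
  also have "\<dots> = ennreal ((\<Sum>i\<in>UNIV. p i * sqrt 2) + (1 - sum p UNIV) * sqrt 2)"
    using p by (simp add: ennreal_plus sum_nonneg ennreal_mult' flip: sum_ennreal)
  also have "(\<Sum>i\<in>UNIV. p i * sqrt 2) + (1 - sum p UNIV) * sqrt 2 = sqrt 2"
    by (simp add: left_diff_distrib flip: sum_distrib_right)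
  finally show ?thesis .
qed

lemma prob_qform_gt_le:
  assumes "psd B" "rtrace B \<le> 1"
  shows "prob {\<omega> \<in> space W. \<alpha> < qform B (phases \<omega>)} \<le> 4 * exp (- \<alpha> / 4)"
proof -
  note [measurable] = measurable_qform_phases [OF assms(1)]
  let ?E = "{\<omega> \<in> space W. \<alpha> < qform B (phases \<omega>)}"
  have "emeasure W ?E = (\<integral>\<^sup>+\<omega>. indicator ?E \<omega> \<partial>W)"
    by (simp add: nn_integral_indicator)
  \<comment> \<open>Markov's inequality: on the event the integrand is at least 1.\<close>
  also have "\<dots> \<le> (\<integral>\<^sup>+\<omega>. ennreal (exp (- \<alpha> / 4)) * ennreal (exp (qform B (phases \<omega>) / 4)) \<partial>W)"
    by (intro nn_integral_mono) (auto simp: indicator_def simp flip: ennreal_mult' exp_add)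
  also have "\<dots> = ennreal (exp (- \<alpha> / 4)) * (\<integral>\<^sup>+\<omega>. ennreal (exp (qform B (phases \<omega>) / 4)) \<partial>W)"
    by (intro nn_integral_cmult) measurable
  also have "\<dots> \<le> ennreal (exp (- \<alpha> / 4)) * ennreal (sqrt 2)"
    by (intro mult_left_mono nn_integral_exp_qform_le assms) auto
  also have "\<dots> = ennreal (exp (- \<alpha> / 4) * sqrt 2)"
    by (simp add: ennreal_mult')
  finally have "prob ?E \<le> exp (- \<alpha> / 4) * sqrt 2"
    by (simp add: emeasure_eq_measure)
  also have "\<dots> \<le> exp (- \<alpha> / 4) * 4"
    using real_sqrt_le_mono [of 2 16] by (intro mult_left_mono) auto
  finally show ?thesis by (simp add: mult.commute)
qed

end

subsection \<open>The relaxation and the randomized procedure\<close>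

lemma psd_ext_constraints:
  assumes "P > 0" "\<forall>k\<in>{1..K}. psd (Q k)" "k \<in> {1..K + 1}"
  shows "psd (ext_constraints K P Q k)"
proof (cases "k = K + 1")
  case True
  have "hermitian ((1 / P) *\<^sub>R mat 1 :: complex^'n^'n)"
    by (auto simp: hermitian_def ctranspose_def mat_def vec_eq_iff)
  then show ?thesis
    using assms(1) True
    by (simp add: ext_constraints_def psd_def qform_scaleR_matrix qform_mat_1)
next
  case False
  then show ?thesis using assms by (auto simp: ext_constraints_def)
qed

lemma rtrace_ext_constraints_le:
  assumes "P > 0" "sdp_feasible K P Q X" "k \<in> {1..K + 1}"
  shows "rtrace (ext_constraints K P Q k ** X) \<le> 1"
proof (cases "k = K + 1")
  case True
  have "rtrace (((1 / P) *\<^sub>R mat 1) ** X) = rtrace X / P"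
  proof -
    have "(((1 / P) *\<^sub>R mat 1) ** X) = (1 / P) *\<^sub>R X"
      by (simp add: vec_eq_iff matrix_matrix_mult_def mat_def if_distrib if_distribR cong: if_cong)
    then show ?thesis by (simp add: rtrace_def trace_def sum_divide_distrib)
  qed
  then show ?thesis
    using assms True by (simp add: ext_constraints_def sdp_feasible_def)
next
  case False
  then show ?thesis using assms by (auto simp: ext_constraints_def sdp_feasible_def)
qed

lemma qcqp_feasible_iff_ext_constraints:
  assumes "P > 0"
  shows "qcqp_feasible K P Q x \<longleftrightarrow> (\<forall>k\<in>{1..K + 1}. qform (ext_constraints K P Q k) x \<le> 1)"
proof -
  have "{1..K + 1} = insert (K + 1) {1..K}" by auto
  then show ?thesis
    using assms
    by (auto simp: qcqp_feasible_def ext_constraints_def qform_scaleR_matrix qform_mat_1 cinner_self)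
qed

text \<open>A vector with positive objective can be scaled into the feasible set of the QCQP, and
  its rank-one lift then competes with \<open>X\<close>.\<close>

lemma rtrace_optimal_pos:
  assumes "P > 0" "psd A" "A \<noteq> 0" "\<forall>k\<in>{1..K}. psd (Q k)" "sdp_optimal K P A Q X"
  shows "rtrace (A ** X) > 0"
proof -
  obtain x where x: "qform A x > 0"
    using assms(2,3) psd_eq_0_iff [of A] by (auto simp: psd_def order_less_le)
  let ?q = "\<lambda>k. qform (ext_constraints K P Q k) x"
  have q: "0 \<le> ?q k" if "k \<in> {1..K + 1}" for k
    using psd_ext_constraints [of P K Q, OF assms(1,4) that] by (auto simp: psd_def)
  \<comment> \<open>Since \<open>s\<close> dominates every constraint form, dividing by it brings
    all of them to at most 1; the leading 1 makes \<open>s\<close> positive.\<close>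
  define s where "s = 1 + (\<Sum>k\<in>{1..K + 1}. ?q k)"
  have s: "?q k \<le> s" "s > 0" if "k \<in> {1..K + 1}" for k
    using member_le_sum [of k "{1..K + 1}" ?q] sum_nonneg [of "{1..K + 1}" ?q] q that
    by (auto simp: s_def)
  then have s0: "s > 0" by (metis atLeastAtMost_iff le_add2 order_refl)
  define y where "y = (1 / sqrt s) *\<^sub>R x"
  have y: "qform B y = qform B x / s" for B
    using s0 by (simp add: y_def qform_scaleR power_divide)
  have "qcqp_feasible K P Q y"
    unfolding qcqp_feasible_iff_ext_constraints [OF assms(1)] y using s s0 by simp
  then have "rtrace (A ** rank_one y) \<le> rtrace (A ** X)"
    using assms(5) by (auto simp: sdp_optimal_def intro: sdp_feasible_rank_one)
  moreover have "qform A y > 0" using x s0 by (simp add: y)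
  ultimately show ?thesis by (simp add: rtrace_mult_rank_one)
qed

text \<open>The semidefinite program is a relaxation: each feasible point lifts to a feasible matrix
  with the same objective value.\<close>

lemma qcqp_value_le_rtrace:
  assumes "P > 0" "sdp_optimal K P A Q X"
  shows "qcqp_value K P A Q \<le> rtrace (A ** X)"
  unfolding qcqp_value_def
proof (rule cSUP_least)
  have "qcqp_feasible K P Q 0"
    using assms(1) by (simp add: qcqp_feasible_def qform_def cinner_def)
  then show "{t. qcqp_feasible K P Q t} \<noteq> {}" by blast
next
  fix t
  assume "t \<in> {t. qcqp_feasible K P Q t}"
  then show "qform A t \<le> rtrace (A ** X)"
    using assms(2)
    by (auto simp: sdp_optimal_def simp flip: rtrace_mult_rank_one intro: sdp_feasible_rank_one)
qed

section \<open>The maximal constraint value and the returned vector\<close>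

lemma max_constraint_ge:
  "k \<in> {1..K + 1} \<Longrightarrow>
    qform (transformed D U (ext_constraints K P Q k)) x \<le> max_constraint K P Q D U x"
  unfolding max_constraint_def by (intro Max_ge) auto

lemma max_constraint_nonneg:
  assumes "P > 0" "\<forall>k\<in>{1..K}. psd (Q k)"
  shows "0 \<le> max_constraint K P Q D U x"
proof -
  have k: "K + 1 \<in> {1..K + 1}" by simp
  have "psd (transformed D U (ext_constraints K P Q (K + 1)))"
    by (intro psd_transformed psd_ext_constraints assms k)
  then have "0 \<le> qform (transformed D U (ext_constraints K P Q (K + 1))) x"
    by (simp add: psd_def)
  also have "\<dots> \<le> max_constraint K P Q D U x" by (rule max_constraint_ge [OF k])
  finally show ?thesis .
qed

lemma qform_returned_vector:
  assumes "P > 0" "\<forall>k\<in>{1..K}. psd (Q k)"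
  shows "qform B (returned_vector K P Q D U x)
    = qform (transformed D U B) x / max_constraint K P Q D U x"
  using max_constraint_nonneg [OF assms]
  by (simp add: returned_vector_def qform_scaleR qform_transformed power_divide)

lemma qcqp_feasible_returned_vector:
  assumes "P > 0" "\<forall>k\<in>{1..K}. psd (Q k)"
  shows "qcqp_feasible K P Q (returned_vector K P Q D U x)"
  unfolding qcqp_feasible_iff_ext_constraints [OF assms(1)]
proof
  fix k assume "k \<in> {1..K + 1}"
  then have "qform (transformed D U (ext_constraints K P Q k)) x \<le> max_constraint K P Q D U x"
    by (rule max_constraint_ge)
  with max_constraint_nonneg [of P K Q D U x, OF assms]
  show "qform (ext_constraints K P Q k) (returned_vector K P Q D U x) \<le> 1"
    \<comment> \<open>If the maximum is 0, division by zero makes the returned vector 0, which is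
      feasible.\<close>
    by (cases "max_constraint K P Q D U x = 0")
       (simp_all add: qform_returned_vector [OF assms] divide_le_eq_1)
qed

text \<open>The power constraint, with index \<open>K + 1\<close>, is a positive multiple of the
  squared norm, so it suffices that \<open>y\<close> is nonzero, which a positive objective
  guarantees.\<close>

lemma max_constraint_pos:
  assumes "P > 0" "\<forall>k\<in>{1..K}. psd (Q k)" "qform (transformed D U A) x > 0"
  shows "max_constraint K P Q D U x > 0"
proof -
  define y where "y = ctranspose D *v (U *v x)"
  have "y \<noteq> 0"
    using assms(3) by (auto simp: qform_transformed simp flip: y_def)
  then have "0 < qform (transformed D U (ext_constraints K P Q (K + 1))) x"
    using assms(1)
    by (simp add: qform_transformed ext_constraints_def qform_scaleR_matrix qform_mat_1 flip: y_def)
  also have "\<dots> \<le> max_constraint K P Q D U x" by (rule max_constraint_ge) simp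
  finally show ?thesis .
qed

text \<open>Positivity of the denominator is claimed for \<open>A \<noteq> 0\<close>: when
  \<open>A = 0\<close>, the matrix \<open>X = 0\<close> is optimal and makes the maximum vanish. The
  factor \<open>D\<close> and the unitary \<open>U\<close> are arbitrary admissible choices.\<close>

theorem theorem2:
  fixes K :: nat and P :: real
    and A X D U :: "complex^'m^'m"
    and Q :: "nat \<Rightarrow> complex^'m^'m"
    and W :: "'w measure"
    and \<theta> :: "'m \<Rightarrow> 'w \<Rightarrow> real"
    and \<xi> t :: "'w \<Rightarrow> complex^'m"
    and \<mu> :: real
  assumes "K \<ge> 1" and "P > 0"
    and "psd A" and "\<And>k. k \<in> {1..K} \<Longrightarrow> psd (Q k)"
    and "sdp_optimal K P A Q X"
    and "valid_choice A X D U"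
    and "prob_space W"
    and "prob_space.indep_vars W (\<lambda>_. borel) \<theta> UNIV"
    and "\<And>i. distr W borel (\<theta> i) = uniform_measure lborel {0..2 * pi}"
  defines "\<xi> \<equiv> \<lambda>\<omega>. phase_vector (\<lambda>i. \<theta> i \<omega>)"
    and "t \<equiv> \<lambda>\<omega>. returned_vector K P Q D U (\<xi> \<omega>)"
    and "\<mu> \<equiv> min (sqrt (real (K + 1))) (real CARD('m))"
  shows "(A \<noteq> 0 \<longrightarrow> (\<forall>\<omega>\<in>space W. max_constraint K P Q D U (\<xi> \<omega>) > 0)) \<and>
    (\<forall>\<omega>\<in>space W. qcqp_feasible K P Q (t \<omega>)) \<and>
    (\<forall>\<alpha>>0. measure W {\<omega> \<in> space W. qform A (t \<omega>) \<ge> 1 / \<alpha> * rtrace (A ** X)}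
      \<ge> 1 - 4 * real (K + 1) * \<mu> * exp (- \<alpha> / 4)) \<and>
    (\<forall>\<alpha>>0. measure W {\<omega> \<in> space W. qform A (t \<omega>) \<ge> 1 / \<alpha> * qcqp_value K P A Q}
      \<ge> 1 - 4 * real (K + 1) * \<mu> * exp (- \<alpha> / 4))"
proof -
  interpret random_phases W \<theta>
    using assms(7-9) by (simp add: random_phases_def random_phases_axioms_def)
  have psd_Q: "\<forall>k\<in>{1..K}. psd (Q k)" using assms(4) by blast
  note Q = assms(2) psd_Q
  let ?m = "\<lambda>\<omega>. max_constraint K P Q D U (\<xi> \<omega>)"
  let ?q = "\<lambda>k \<omega>. qform (transformed D U (ext_constraints K P Q k)) (\<xi> \<omega>)"
  let ?b = "\<lambda>\<alpha>. 4 * real (K + 1) * \<mu> * exp (- \<alpha> / 4)"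
  have feas: "sdp_feasible K P Q X" using assms(5) by (simp add: sdp_optimal_def)
  have psd: "psd (transformed D U (ext_constraints K P Q k))" if "k \<in> {1..K + 1}" for k
    by (intro psd_transformed psd_ext_constraints Q that)
  have A_\<xi>: "qform (transformed D U A) (\<xi> \<omega>) = rtrace (A ** X)" for \<omega>
    unfolding \<xi>_def using assms(6)
    by (simp add: valid_choice_def qform_diagonal_phase_vector rtrace_transformed [OF assms(6)])
  have A_t: "qform A (t \<omega>) = rtrace (A ** X) / ?m \<omega>" for \<omega>
    unfolding t_def qform_returned_vector [OF Q] A_\<xi> ..
  have m_pos: "?m \<omega> > 0" if "A \<noteq> 0" for \<omega>
    using rtrace_optimal_pos [OF assms(2,3) that psd_Q assms(5)]
    by (intro max_constraint_pos [where A = A] Q) (simp add: A_\<xi>)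
  have q_meas [measurable]: "?q k \<in> borel_measurable W" if "k \<in> {1..K + 1}" for k
    unfolding \<xi>_def by (intro measurable_qform_phases psd that)
  have m_meas [measurable]: "?m \<in> borel_measurable W"
    unfolding max_constraint_def using q_meas by (intro borel_measurable_Max) auto
  have A_meas [measurable]: "(\<lambda>\<omega>. qform A (t \<omega>)) \<in> borel_measurable W"
    unfolding A_t by measurable
  \<comment> \<open>The union bound gives the failure probability with factor
    \<open>4 * (K + 1)\<close>; multiplying by \<open>\<mu> \<ge> 1\<close> only enlarges
    it.\<close>
  have \<mu>: "\<mu> \<ge> 1" unfolding \<mu>_def by (simp add: Suc_le_eq)
  have tail: "1 - ?b \<alpha> \<le> prob {\<omega> \<in> space W. qform A (t \<omega>) \<ge> 1 / \<alpha> * rtrace (A ** X)}"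
    (is "_ \<le> prob ?G") if \<alpha>: "\<alpha> > 0" for \<alpha>
  proof (cases "A = 0")
    case True
    \<comment> \<open>Objective and threshold are both 0, so the event is the whole space.\<close>
    then have "rtrace (A ** X) = 0" by (simp add: rtrace_def trace_def)
    then have "?G = space W" by (auto simp: A_t)
    then show ?thesis using \<mu> by (simp add: prob_space)
  next
    case False
    let ?E = "\<lambda>k. {\<omega> \<in> space W. \<alpha> < ?q k \<omega>}"
    have E: "?E k \<in> events" if "k \<in> {1..K + 1}" for k
      using q_meas [OF that] by measurable
    \<comment> \<open>The objective is the trace divided by the maximum, so missing the threshold
      forces the maximum above \<open>\<alpha>\<close>, and then one of the finitely many forms
      exceeds \<open>\<alpha>\<close>.\<close>
    have "space W - ?G \<subseteq> (\<Union>k\<in>{1..K + 1}. ?E k)"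
    proof
      fix \<omega> assume \<omega>: "\<omega> \<in> space W - ?G"
      have "\<not> ?m \<omega> \<le> \<alpha>"
      proof
        assume "?m \<omega> \<le> \<alpha>"
        then have "rtrace (A ** X) / \<alpha> \<le> rtrace (A ** X) / ?m \<omega>"
          using m_pos [OF False] \<alpha> rtrace_optimal_pos [OF assms(2,3) False psd_Q assms(5)]
          by (intro divide_left_mono) auto
        then show False using \<omega> by (simp add: A_t)
      qed
      then have "\<exists>k\<in>{1..K + 1}. \<alpha> < ?q k \<omega>"
        unfolding max_constraint_def not_le by (subst (asm) Max_gr_iff) auto
      then show "\<omega> \<in> (\<Union>k\<in>{1..K + 1}. ?E k)" using \<omega> by blast
    qed
    then have "prob (space W - ?G) \<le> prob (\<Union>k\<in>{1..K + 1}. ?E k)"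
      using E by (intro finite_measure_mono) auto
    also have "\<dots> \<le> (\<Sum>k\<in>{1..K + 1}. prob (?E k))"
      using E by (intro finite_measure_subadditive_finite) auto
    also have "\<dots> \<le> (\<Sum>k\<in>{1..K + 1}. 4 * exp (- \<alpha> / 4))"
    proof (rule sum_mono)
      fix k assume k: "k \<in> {1..K + 1}"
      have "rtrace (transformed D U (ext_constraints K P Q k)) \<le> 1"
        unfolding rtrace_transformed [OF assms(6)]
        by (rule rtrace_ext_constraints_le [OF assms(2) feas k])
      with psd [OF k] show "prob (?E k) \<le> 4 * exp (- \<alpha> / 4)"
        unfolding \<xi>_def by (rule prob_qform_gt_le)
    qed
    also have "\<dots> = 4 * real (K + 1) * 1 * exp (- \<alpha> / 4)" by simp
    also have "\<dots> \<le> ?b \<alpha>"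
      using \<mu> by (intro mult_right_mono mult_left_mono) auto
    finally have "prob (space W - ?G) \<le> ?b \<alpha>" .
    moreover have "?G \<in> events" by measurable
    ultimately show ?thesis by (simp add: prob_compl)
  qed
  have "1 - ?b \<alpha> \<le> prob {\<omega> \<in> space W. qform A (t \<omega>) \<ge> 1 / \<alpha> * qcqp_value K P A Q}"
    if \<alpha>: "\<alpha> > 0" for \<alpha>
  proof (rule order_trans [OF tail [OF \<alpha>]], rule finite_measure_mono)
    \<comment> \<open>The QCQP value is at most the relaxed optimum, so the threshold drops and the
      event grows.\<close>
    have "1 / \<alpha> * qcqp_value K P A Q \<le> 1 / \<alpha> * rtrace (A ** X)"
      using qcqp_value_le_rtrace [OF assms(2,5)] \<alpha> by (intro mult_left_mono) auto
    then show "{\<omega> \<in> space W. qform A (t \<omega>) \<ge> 1 / \<alpha> * rtrace (A ** X)}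
        \<subseteq> {\<omega> \<in> space W. qform A (t \<omega>) \<ge> 1 / \<alpha> * qcqp_value K P A Q}"
      by auto
  qed measurable
  with tail m_pos qcqp_feasible_returned_vector [OF Q] show ?thesis
    unfolding t_def by auto
qed

end
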